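(* Let $\langle\mathcal{U},\mathcal{S}\rangle$ be an instance of the set splitting problem in simple form, with $\mathcal{U}=\{1,\dots,u\}$ and $\mathcal{S}=\{S^1,\dots,S^s\}$, put $c=\sum_{i=1}^s|S^i|$, and let $\Gamma=\langle V,E\rangle$ be the directed graph constructed from it as described in the context. Then $$|V|=4u+5s+6c+2\qquad\text{and}\qquad |E|=7u+s+18c+2 .$$
   Context: **Set splitting problem (SSP).** An instance is a finite universe set $\mathcal{U}$ and a family $\mathcal{S}$ of subsets of $\mathcal{U}$; the question is whether $\mathcal{U}$ can be partitioned into two disjoint non-empty subsets, neither of which contains any $S\in\mathcal{S}$. **Simple form.** The instance ($\mathcal{U}=\{1,\dots,u\}$ with $u\ge 1$, $\mathcal{S}=\{S^1,\dots,S^s\}$ with the $S^i$ distinct) is in simple form if: no $S^i$ has exactly one element; every element of $\mathcal{U}$ lies in some $S^i$; no $S^i$ equals $\mathcal{U}$; and no $S^i$ is a subset of another $S^j$, $j\neq i$. (It follows that $s\ge1$ and $|S^i|\ge 2$ for all $i$.) The elements of $S^i$ are listed in ascending order as $s^i_1<s^i_2<\dots<s^i_{|S^i|}$. **Construction of $\Gamma=\langle V,E\rangle$.** The vertices (all distinct) are: $v^{U,i}_1,v^{U,i}_2,v^{U,i}_3,v^{U,i}_4$ for each $i\in\mathcal{U}$; $v^{S,i}_1,\dots,v^{S,i}_{5+6|S^i|}$ for each $i=1,\dots,s$; and $v^C_1,v^C_2$. $E$ is the set of the following directed edges. 1. For each $i\in\mathcal{U}$: $(v^{U,i}_1,v^{U,i}_2)$,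 $(v^{U,i}_1,v^{U,i}_3)$, $(v^{U,i}_2,v^{U,i}_3)$, $(v^{U,i}_3,v^{U,i}_2)$. 2. For each $i=1,\dots,s$, writing $k=|S^i|$, $w_m=v^{S,i}_m$, $a_j=3+3j$, $b_j=4+3j$, $c_j=5+3j$: - Group I: $(w_1,w_6)$, $(w_1,w_{6+3k})$, $(w_{5+3k},w_2)$, $(w_{5+6k},w_2)$, $(w_3,w_4)$, $(w_4,w_3)$, $(w_4,w_5)$, $(w_5,w_4)$. - Group II, for $j=1,\dots,k$: $(w_{a_j},w_{b_j})$, $(w_{b_j},w_{a_j})$, $(w_{b_j},w_{c_j})$, $(w_{c_j},w_{b_j})$, $(w_{a_j+3k},w_{b_j+3k})$, $(w_{b_j+3k},w_{a_j+3k})$, $(w_{b_j+3k},w_{c_j+3k})$, $(w_{c_j+3k},w_{b_j+3k})$. - Group III, for $j=1,\dots,k-1$: $(w_{c_j},w_{c_j+1})$, $(w_{c_j},w_{c_j+1+3k})$, $(w_{c_j+3k},w_{c_j+1})$, $(w_{c_j+3k},w_{c_j+1+3k})$, $(w_{c_j},w_3)$, $(w_3,w_{c_j+1})$, $(w_{c_j+3k},w_5)$, $(w_5,w_{c_j+3k+1})$. 3. Linking edges: $(v^{U,u}_4,v^C_1)$, $(v^C_1,v^{S,1}_1)$, $(v^{S,s}_2,v^C_2)$, $(v^C_2,v^{U,1}_1)$; $(v^{U,i}_4,v^{U,i+1}_1)$ for $i=1,\dots,u-1$; and $(v^{S,j}_2,v^{S,j+1}_1)$ for $j=1,\dots,s-1$.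 4. For each $i\in\mathcal{U}$, let $F^i=(F^i_1,\dots,F^i_f)$ be the increasing list of the indices of the subsets in $\mathcal{S}$ containing $i$ (so $f=|F^i|$), and let $R^i_j$ be the position of $i$ in the ordered list $S^{F^i_j}$. Put $d_{ij}=3+3R^i_j$ and $e_{ij}=3+3|S^{F^i_j}|+3R^i_j$. The edges are $(v^{U,i}_2,v^{S,F^i_1}_{2+e_{i1}})$, $(v^{S,F^i_f}_{e_{if}},v^{U,i}_4)$, $(v^{U,i}_3,v^{S,F^i_1}_{2+d_{i1}})$, $(v^{S,F^i_f}_{d_{if}},v^{U,i}_4)$, and, for $j=1,\dots,f-1$, $(v^{S,F^i_j}_{e_{ij}},v^{S,F^i_{j+1}}_{2+e_{i,j+1}})$ and $(v^{S,F^i_j}_{d_{ij}},v^{S,F^i_{j+1}}_{2+d_{i,j+1}})$. *)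

theory Defs
  imports Main "Graph_Theory.Pair_Digraph"
begin

text \<open>
  An instance of the set splitting problem has universe \<open>{1..u}\<close> and the family
  \<open>{S 1, \<dots>, S s}\<close>.  The values of \<open>S\<close> outside \<open>{1..s}\<close> are irrelevant.
\<close>

definition ssp_instance :: "nat \<Rightarrow> nat \<Rightarrow> (nat \<Rightarrow> nat set) \<Rightarrow> bool" where
  "ssp_instance u s S \<longleftrightarrow>
     u \<ge> 1 \<and> (\<forall>i\<in>{1..s}. S i \<subseteq> {1..u}) \<and> inj_on S {1..s}"

definition simple_form :: "nat \<Rightarrow> nat \<Rightarrow> (nat \<Rightarrow> nat set) \<Rightarrow> bool" where
  "simple_form u s S \<longleftrightarrow>
     (\<forall>i\<in>{1..s}. card (S i) \<noteq> 1) \<and>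
     (\<forall>x\<in>{1..u}. \<exists>i\<in>{1..s}. x \<in> S i) \<and>
     (\<forall>i\<in>{1..s}. S i \<noteq> {1..u}) \<and>
     (\<forall>i\<in>{1..s}. \<forall>j\<in>{1..s}. j \<noteq> i \<longrightarrow> \<not> S i \<subseteq> S j)"

text \<open>
  \<open>VU i m\<close>, \<open>VS i m\<close> and \<open>VC m\<close> stand for $v^{U,i}_m$, $v^{S,i}_m$ and $v^C_m$.
\<close>

datatype vertex = VU nat nat | VS nat nat | VC nat

definition gamma_verts :: "nat \<Rightarrow> nat \<Rightarrow> (nat \<Rightarrow> nat set) \<Rightarrow> vertex set" where
  "gamma_verts u s S =
     {VU i m | i m. i \<in> {1..u} \<and> m \<in> {1..4}} \<union>
     {VS i m | i m. i \<in> {1..s} \<and> m \<in> {1..5 + 6 * card (S i)}} \<union>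
     {VC 1, VC 2}"

definition universe_edges :: "nat \<Rightarrow> vertex rel" where
  "universe_edges i =
     {(VU i 1, VU i 2), (VU i 1, VU i 3), (VU i 2, VU i 3), (VU i 3, VU i 2)}"

definition subset_edges_I :: "(nat \<Rightarrow> nat set) \<Rightarrow> nat \<Rightarrow> vertex rel" where
  "subset_edges_I S i =
     (let k = card (S i); w = VS i in
      {(w 1, w 6), (w 1, w (6 + 3 * k)),
       (w (5 + 3 * k), w 2), (w (5 + 6 * k), w 2),
       (w 3, w 4), (w 4, w 3), (w 4, w 5), (w 5, w 4)})"

definition subset_edges_II :: "(nat \<Rightarrow> nat set) \<Rightarrow> nat \<Rightarrow> vertex rel" where
  "subset_edges_II S i =
     (let k = card (S i); w = VS i in
      \<Union>j\<in>{1..k}. let a = 3 + 3 * j; b = 4 + 3 * j; c = 5 + 3 * j in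
        {(w a, w b), (w b, w a), (w b, w c), (w c, w b),
         (w (a + 3 * k), w (b + 3 * k)), (w (b + 3 * k), w (a + 3 * k)),
         (w (b + 3 * k), w (c + 3 * k)), (w (c + 3 * k), w (b + 3 * k))})"

definition subset_edges_III :: "(nat \<Rightarrow> nat set) \<Rightarrow> nat \<Rightarrow> vertex rel" where
  "subset_edges_III S i =
     (let k = card (S i); w = VS i in
      \<Union>j\<in>{1..<k}. let c = 5 + 3 * j in
        {(w c, w (c + 1)), (w c, w (c + 1 + 3 * k)),
         (w (c + 3 * k), w (c + 1)), (w (c + 3 * k), w (c + 1 + 3 * k)),
         (w c, w 3), (w 3, w (c + 1)),
         (w (c + 3 * k), w 5), (w 5, w (c + 3 * k + 1))})"

definition linking_edges :: "nat \<Rightarrow> nat \<Rightarrow> vertex rel" where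
  "linking_edges u s =
     {(VU u 4, VC 1), (VC 1, VS 1 1), (VS s 2, VC 2), (VC 2, VU 1 1)} \<union>
     (\<Union>i\<in>{1..<u}. {(VU i 4, VU (i + 1) 1)}) \<union>
     (\<Union>j\<in>{1..<s}. {(VS j 2, VS (j + 1) 1)})"

text \<open>One-based access to lists, and the one-based position in a list without repetitions.\<close>

definition nth1 :: "'a list \<Rightarrow> nat \<Rightarrow> 'a" where
  "nth1 xs j = xs ! (j - 1)"

definition position :: "'a \<Rightarrow> 'a list \<Rightarrow> nat" where
  "position x xs = (THE r. r \<in> {1..length xs} \<and> nth1 xs r = x)"

text \<open>
  \<open>F_list s S i\<close> is the list $F^i$, and \<open>R_pos s S i j\<close>, \<open>d_idx s S i j\<close>, \<open>e_idx s S i j\<close>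
  are $R^i_j$, $d_{ij}$, $e_{ij}$.
\<close>

definition F_list :: "nat \<Rightarrow> (nat \<Rightarrow> nat set) \<Rightarrow> nat \<Rightarrow> nat list" where
  "F_list s S i = sorted_list_of_set {p \<in> {1..s}. i \<in> S p}"

definition R_pos :: "nat \<Rightarrow> (nat \<Rightarrow> nat set) \<Rightarrow> nat \<Rightarrow> nat \<Rightarrow> nat" where
  "R_pos s S i j = position i (sorted_list_of_set (S (nth1 (F_list s S i) j)))"

definition d_idx :: "nat \<Rightarrow> (nat \<Rightarrow> nat set) \<Rightarrow> nat \<Rightarrow> nat \<Rightarrow> nat" where
  "d_idx s S i j = 3 + 3 * R_pos s S i j"

definition e_idx :: "nat \<Rightarrow> (nat \<Rightarrow> nat set) \<Rightarrow> nat \<Rightarrow> nat \<Rightarrow> nat" where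
  "e_idx s S i j = 3 + 3 * card (S (nth1 (F_list s S i) j)) + 3 * R_pos s S i j"

definition return_edges :: "nat \<Rightarrow> (nat \<Rightarrow> nat set) \<Rightarrow> nat \<Rightarrow> vertex rel" where
  "return_edges s S i =
     (let F = nth1 (F_list s S i); f = length (F_list s S i);
          d = d_idx s S i; e = e_idx s S i in
      {(VU i 2, VS (F 1) (2 + e 1)), (VS (F f) (e f), VU i 4),
       (VU i 3, VS (F 1) (2 + d 1)), (VS (F f) (d f), VU i 4)} \<union>
      (\<Union>j\<in>{1..<f}.
        {(VS (F j) (e j), VS (F (j + 1)) (2 + e (j + 1))),
         (VS (F j) (d j), VS (F (j + 1)) (2 + d (j + 1)))}))"

definition gamma_edges :: "nat \<Rightarrow> nat \<Rightarrow> (nat \<Rightarrow> nat set) \<Rightarrow> vertex rel" where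
  "gamma_edges u s S =
     (\<Union>i\<in>{1..u}. universe_edges i) \<union>
     (\<Union>i\<in>{1..s}. subset_edges_I S i \<union> subset_edges_II S i \<union> subset_edges_III S i) \<union>
     linking_edges u s \<union>
     (\<Union>i\<in>{1..u}. return_edges s S i)"

definition Gamma :: "nat \<Rightarrow> nat \<Rightarrow> (nat \<Rightarrow> nat set) \<Rightarrow> vertex pair_pre_digraph" where
  "Gamma u s S = \<lparr>pverts = gamma_verts u s S, parcs = gamma_edges u s S\<rparr>"

end

theory Submission
  imports Defs
begin

text \<open>
  The four kinds of edges are told apart by their end points: universe edges stay inside one
  universe gadget and never start at its fourth vertex, subset edges stay inside one subset gadget,
  linking edges that join two gadgets end at a first vertex, and return edges do neither.  Among the
  return edges no two have the same source, and the source determines the element of the universe to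
  which the edge belongs.  So all cardinalities add up, and
  $\sum_i |F^i| = \sum_p |S^p|$ by double counting.
\<close>

section \<open>Counting the vertices\<close>

lemma card_gamma_verts:
  "card (gamma_verts u s S) = 4 * u + 5 * s + 6 * (\<Sum>i=1..s. card (S i)) + 2"
proof -
  let ?A = "{VU i m | i m. i \<in> {1..u} \<and> m \<in> {1..4}}"
  let ?B = "{VS i m | i m. i \<in> {1..s} \<and> m \<in> {1..5 + 6 * card (S i)}}"
  have A: "?A = (\<lambda>(i, m). VU i m) ` ({1..u} \<times> {1..4})" by auto
  have B: "?B = (\<lambda>(i, m). VS i m) ` (SIGMA i:{1..s}. {1..5 + 6 * card (S i)})" by auto
  have cA: "card ?A = 4 * u"
    unfolding A by (subst card_image) (auto simp: inj_on_def)
  have cB: "card ?B = 5 * s + 6 * (\<Sum>i=1..s. card (S i))"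
    unfolding B
    by (subst card_image) (auto simp: inj_on_def card_SigmaI sum_distrib_left sum.distrib sum_Suc)
  have fin: "finite ?A" "finite ?B"
    unfolding A B by auto
  have "card (?A \<union> ?B) = card ?A + card ?B"
    using fin by (intro card_Un_disjoint) auto
  moreover have "card (?A \<union> ?B \<union> {VC 1, VC 2}) = card (?A \<union> ?B) + card {VC 1, VC 2}"
    using fin by (intro card_Un_disjoint) auto
  moreover have "card {VC 1, VC 2} = 2"
    by simp
  ultimately show ?thesis
    unfolding gamma_verts_def cA cB by linarith
qed

section \<open>Edges inside the gadgets and linking edges\<close>

lemma card_UN_universe_edges: "card (\<Union>i\<in>{1..u}. universe_edges i) = 4 * u"
proof -
  have "card (\<Union>i\<in>{1..u}. universe_edges i) = (\<Sum>i=1..u. card (universe_edges i))"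
    by (rule card_UN_disjoint) (auto simp: universe_edges_def)
  then show ?thesis
    by (simp add: universe_edges_def)
qed

text \<open>With \<open>k = 0\<close> the two edges leaving \<open>w 1\<close> would coincide, and
  so would the two entering \<open>w 2\<close>.\<close>

lemma card_subset_edges_I:
  "card (S i) \<ge> 1 \<Longrightarrow> card (subset_edges_I S i) = 8"
  by (simp add: subset_edges_I_def Let_def)

text \<open>Blocks with different \<open>j\<close> share no vertex: the indices \<open>a\<close>,
  \<open>b\<close>, \<open>c\<close> fill 6 to 5 + 3k, and their shifted copies fill 6 + 3k to 5 +
  6k.\<close>

lemma card_subset_edges_II:
  "card (subset_edges_II S i) = 8 * card (S i)"
  unfolding subset_edges_II_def Let_def
proof (subst card_UN_disjoint, goal_cases)
  case 3
  show ?case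
    by auto
qed (simp_all add: card_insert_if)

lemma card_subset_edges_III:
  "card (subset_edges_III S i) = 8 * (card (S i) - 1)"
  unfolding subset_edges_III_def Let_def
proof (subst card_UN_disjoint, goal_cases)
  case 3
  show ?case
    by auto
qed (simp_all add: card_insert_if)

lemma finite_subset_edges:
  "finite (subset_edges_I S i)" "finite (subset_edges_II S i)" "finite (subset_edges_III S i)"
  by (simp_all add: subset_edges_I_def subset_edges_II_def subset_edges_III_def Let_def)

text \<open>Every group II edge has an end with index 1 mod 3, and no group III edge does. A group I
  edge has an end with index 1 or 2 or stays within 3 to 5, whereas group II uses only indices from
  6 on, and a group III edge avoids 1 and 2 and has an end with index at least 8.\<close>

lemma subset_edges_disjoint:
  assumes "card (S i) \<ge> 1"
  shows "subset_edges_I S i \<inter> subset_edges_II S i = {}"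
    and "subset_edges_I S i \<inter> subset_edges_III S i = {}"
    and "subset_edges_II S i \<inter> subset_edges_III S i = {}"
  using assms
  unfolding subset_edges_I_def subset_edges_II_def subset_edges_III_def Let_def
  by auto presburger+

lemma card_linking_edges:
  assumes "u \<ge> 1" "s \<ge> 1"
  shows "card (linking_edges u s) = u + s + 2"
proof -
  let ?A = "{(VU u 4, VC 1), (VC 1, VS 1 1), (VS s 2, VC 2), (VC 2, VU 1 1)}"
  let ?B = "\<Union>i\<in>{1..<u}. {(VU i 4, VU (i + 1) 1)}"
  let ?C = "\<Union>j\<in>{1..<s}. {(VS j 2, VS (j + 1) 1)}"
  have "card (?A \<union> ?B \<union> ?C) = card ?A + card ?B + card ?C"
    by (subst card_Un_disjoint; (subst card_Un_disjoint)?) auto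
  moreover have "card ?A = 4" by simp
  moreover have "card ?B = u - 1" by (subst card_UN_disjoint) auto
  moreover have "card ?C = s - 1" by (subst card_UN_disjoint) auto
  ultimately show ?thesis
    using assms unfolding linking_edges_def by linarith
qed

section \<open>One-based positions in lists\<close>

lemma nth1_in_set: "j \<in> {1..length xs} \<Longrightarrow> nth1 xs j \<in> set xs"
  by (auto simp: nth1_def)

lemma nth1_eq_iff:
  "distinct xs \<Longrightarrow> j \<in> {1..length xs} \<Longrightarrow> k \<in> {1..length xs} \<Longrightarrow> nth1 xs j = nth1 xs k \<longleftrightarrow> j = k"
  by (auto simp: nth1_def nth_eq_iff_index_eq)

lemma position_properties:
  assumes "distinct xs" "x \<in> set xs"
  shows "position x xs \<in> {1..length xs}" "nth1 xs (position x xs) = x"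
proof -
  obtain k where "k < length xs" "xs ! k = x"
    using assms(2) by (auto simp: in_set_conv_nth)
  then have k: "Suc k \<in> {1..length xs} \<and> nth1 xs (Suc k) = x"
    by (simp add: nth1_def)
  then have "\<exists>!r. r \<in> {1..length xs} \<and> nth1 xs r = x"
    using nth1_eq_iff[OF assms(1)] by blast
  from theI'[OF this] show "position x xs \<in> {1..length xs}" "nth1 xs (position x xs) = x"
    unfolding position_def by auto
qed

section \<open>Consequences of simple form, and the lists of subsets containing an element\<close>

locale simple_ssp =
  fixes u s :: nat and S :: "nat \<Rightarrow> nat set"
  assumes is_instance: "ssp_instance u s S" and simple: "simple_form u s S"
begin

lemma u_pos: "u \<ge> 1"
  using is_instance by (simp add: ssp_instance_def)

lemma covered: "x \<in> {1..u} \<Longrightarrow> \<exists>i\<in>{1..s}. x \<in> S i"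
  using simple by (simp add: simple_form_def)

lemma s_pos: "s \<ge> 1"
  using covered[of 1] u_pos by auto

lemma S_subset: "i \<in> {1..s} \<Longrightarrow> S i \<subseteq> {1..u}"
  using is_instance by (simp add: ssp_instance_def)

lemma finite_S: "i \<in> {1..s} \<Longrightarrow> finite (S i)"
  using S_subset finite_subset by blast

text \<open>An empty subset would be contained in the member of the family that covers 1.\<close>

lemma card_S_pos:
  assumes "i \<in> {1..s}"
  shows "card (S i) \<ge> 1"
proof -
  obtain j where j: "j \<in> {1..s}" "1 \<in> S j"
    using covered[of 1] u_pos by auto
  have "S i \<noteq> {}"
  proof
    assume "S i = {}"
    moreover from this have "j \<noteq> i" using j by auto
    ultimately show False
      using simple assms j unfolding simple_form_def by blast
  qed
  then show ?thesis
    using finite_S[OF assms] by (simp add: Suc_leI card_gt_0_iff)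
qed

lemma set_F_list: "set (F_list s S i) = {p \<in> {1..s}. i \<in> S p}"
  and distinct_F_list: "distinct (F_list s S i)"
  and length_F_list: "length (F_list s S i) = card {p \<in> {1..s}. i \<in> S p}"
  by (simp_all add: F_list_def)

text \<open>Guarantees that the first and last entries used by \<open>return_edges\<close>
  exist.\<close>

lemma F_list_nonempty:
  assumes "i \<in> {1..u}"
  shows "length (F_list s S i) \<ge> 1"
  using covered[OF assms] set_F_list[of i] by (cases "F_list s S i") auto

lemma sum_length_F_list:
  "(\<Sum>i=1..u. length (F_list s S i)) = (\<Sum>p=1..s. card (S p))"
proof -
  have "(\<Sum>i=1..u. length (F_list s S i)) = (\<Sum>p=1..s. card {i \<in> {1..u}. i \<in> S p})"
    unfolding length_F_list by (rule sum_multicount_gen) auto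
  also have "\<dots> = (\<Sum>p=1..s. card (S p))"
    using S_subset by (intro sum.cong refl arg_cong[of _ _ card]) blast+
  finally show ?thesis .
qed

lemma F_properties:
  assumes "j \<in> {1..length (F_list s S i)}"
  defines "p \<equiv> nth1 (F_list s S i) j"
  shows "p \<in> {1..s}" "i \<in> S p" "R_pos s S i j \<in> {1..card (S p)}"
    "nth1 (sorted_list_of_set (S p)) (R_pos s S i j) = i"
proof -
  have "p \<in> set (F_list s S i)"
    unfolding p_def using assms(1) by (rule nth1_in_set)
  then show p: "p \<in> {1..s}" "i \<in> S p"
    by (simp_all add: set_F_list)
  have "i \<in> set (sorted_list_of_set (S p))"
    using p finite_S by simp
  from position_properties[OF _ this]
  show "R_pos s S i j \<in> {1..card (S p)}" "nth1 (sorted_list_of_set (S p)) (R_pos s S i j) = i"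
    by (simp_all add: R_pos_def p_def)
qed

section \<open>Return edges\<close>

text \<open>
  The element to which a return edge with the given source belongs: in the
  gadget of \<open>S p\<close>, where \<open>k = card (S p)\<close>, the edges that start at the vertices with index
  \<open>3 + 3 * R\<close> and \<open>3 + 3 * (R + k)\<close> belong to the \<open>R\<close>-th element of \<open>S p\<close>.
\<close>

fun element_of :: "vertex \<Rightarrow> nat" where
  "element_of (VU i m) = i"
| "element_of (VS p m) =
     (let r = m div 3 - 1; k = card (S p) in
      nth1 (sorted_list_of_set (S p)) (if r \<le> k then r else r - k))"
| "element_of (VC m) = 0"

text \<open>
  The return edges of element \<open>i\<close> form two paths of \<open>|F\<^sup>i| + 1\<close> edges; step 0 leaves the universe
  gadget.
\<close>

definition source_e :: "nat \<Rightarrow> nat \<Rightarrow> vertex" where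
  "source_e i j = (if j = 0 then VU i 2 else VS (nth1 (F_list s S i) j) (e_idx s S i j))"

definition source_d :: "nat \<Rightarrow> nat \<Rightarrow> vertex" where
  "source_d i j = (if j = 0 then VU i 3 else VS (nth1 (F_list s S i) j) (d_idx s S i j))"

definition target_e :: "nat \<Rightarrow> nat \<Rightarrow> vertex" where
  "target_e i j = (if j = length (F_list s S i) then VU i 4
     else VS (nth1 (F_list s S i) (j + 1)) (2 + e_idx s S i (j + 1)))"

definition target_d :: "nat \<Rightarrow> nat \<Rightarrow> vertex" where
  "target_d i j = (if j = length (F_list s S i) then VU i 4
     else VS (nth1 (F_list s S i) (j + 1)) (2 + d_idx s S i (j + 1)))"

text \<open>With two indexed families, counting reduces to comparing sources.\<close>

lemma return_edges_conv:
  assumes "i \<in> {1..u}"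
  shows "return_edges s S i =
    (\<lambda>j. (source_e i j, target_e i j)) ` {0..length (F_list s S i)} \<union>
    (\<lambda>j. (source_d i j, target_d i j)) ` {0..length (F_list s S i)}"
proof -
  define f where "f = length (F_list s S i)"
  have f: "f \<ge> 1"
    using F_list_nonempty[OF assms] by (simp add: f_def)
  \<comment> \<open>The four edges at the universe gadget are steps 0 and \<open>f\<close>, which
    are distinct since \<open>f\<close> is positive; the interior steps are the remaining
    union.\<close>
  then have "{0..f} = insert 0 (insert f {1..<f})"
    by auto
  then show ?thesis
    using f
    unfolding return_edges_def Let_def f_def[symmetric]
    by (auto simp: source_e_def source_d_def target_e_def target_d_def f_def[symmetric])
qed

text \<open>Dividing by 3 and subtracting 1 turns \<open>d_idx\<close> into R and
  \<open>e_idx\<close> into R + k, where R is \<open>R_pos\<close>. Since R lies in 1..k, the test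
  \<open>r \<le> k\<close> separates the cases and both decode to R.\<close>

lemma element_of_source:
  assumes "j \<in> {0..length (F_list s S i)}"
  shows "element_of (source_e i j) = i" "element_of (source_d i j) = i"
  using F_properties[of j i] assms
  by (auto simp: source_e_def source_d_def e_idx_def d_idx_def Let_def)

lemma card_return_edges:
  assumes "i \<in> {1..u}"
  shows "card (return_edges s S i) = 2 * length (F_list s S i) + 2"
proof -
  let ?J = "{0..length (F_list s S i)}"
  have inj: "j = j'" if "source_e i j = source_e i j' \<or> source_d i j = source_d i j'"
    "j \<in> ?J" "j' \<in> ?J" for j j'
    using that nth1_eq_iff[OF distinct_F_list, of j i j']
    by (auto simp: source_e_def source_d_def split: if_splits)
  \<comment> \<open>A common source would lie in a single subset gadget, so \<open>j = j'\<close>;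
    but there \<open>e_idx\<close> exceeds \<open>d_idx\<close> by 3k, and k is positive because
    \<open>R_pos\<close> lies in 1..k.\<close>
  have disj: "source_e i j \<noteq> source_d i j'" if "j \<in> ?J" "j' \<in> ?J" for j j'
  proof
    assume eq: "source_e i j = source_d i j'"
    then have pos: "j \<noteq> 0" "j' \<noteq> 0" and "nth1 (F_list s S i) j = nth1 (F_list s S i) j'"
      by (auto simp: source_e_def source_d_def split: if_splits)
    then have "j = j'"
      using that nth1_eq_iff[OF distinct_F_list, of j i j'] by auto
    moreover have "R_pos s S i j \<in> {1..card (S (nth1 (F_list s S i) j))}"
      using F_properties(3)[of j i] pos that by simp
    ultimately show False
      using eq pos by (simp add: source_e_def source_d_def e_idx_def d_idx_def)
  qed
  have "inj_on (\<lambda>j. (source_e i j, target_e i j)) ?J" "inj_on (\<lambda>j. (source_d i j, target_d i j)) ?J"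
    using inj by (auto intro!: inj_onI)
  then show ?thesis
    unfolding return_edges_conv[OF assms]
    by (subst card_Un_disjoint) (use disj in \<open>auto simp: card_image\<close>)
qed

lemma finite_return_edges: "i \<in> {1..u} \<Longrightarrow> finite (return_edges s S i)"
  by (simp add: return_edges_conv)

lemma card_UN_return_edges:
  "card (\<Union>i\<in>{1..u}. return_edges s S i) = 2 * u + 2 * (\<Sum>p=1..s. card (S p))"
proof -
  have elem: "element_of (fst x) = i" if "x \<in> return_edges s S i" "i \<in> {1..u}" for x i
    using that element_of_source[of _ i] by (auto simp: return_edges_conv)
  have "card (\<Union>i\<in>{1..u}. return_edges s S i) = (\<Sum>i=1..u. card (return_edges s S i))"
    using elem finite_return_edges by (intro card_UN_disjoint) blast+
  also have "\<dots> = (\<Sum>i=1..u. 2 * length (F_list s S i) + 2)"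
    by (intro sum.cong refl card_return_edges)
  also have "\<dots> = 2 * u + 2 * (\<Sum>p=1..s. card (S p))"
    unfolding sum.distrib sum_distrib_left[symmetric] sum_length_F_list by simp
  finally show ?thesis .
qed

section \<open>Adding up the edge counts\<close>

lemma card_UN_subset_edges:
  "card (\<Union>i\<in>{1..s}. subset_edges_I S i \<union> subset_edges_II S i \<union> subset_edges_III S i) =
     16 * (\<Sum>p=1..s. card (S p))"
proof -
  let ?E = "\<lambda>i. subset_edges_I S i \<union> subset_edges_II S i \<union> subset_edges_III S i"
  have inside: "\<exists>m. fst x = VS i m" if "x \<in> ?E i" for x i
    using that
    by (auto simp: subset_edges_I_def subset_edges_II_def subset_edges_III_def Let_def)
  have "card (\<Union>i\<in>{1..s}. ?E i) = (\<Sum>i=1..s. card (?E i))"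
  proof (rule card_UN_disjoint)
    show "\<forall>i\<in>{1..s}. \<forall>j\<in>{1..s}. i \<noteq> j \<longrightarrow> ?E i \<inter> ?E j = {}"
      using inside by (metis disjoint_iff vertex.inject(2))
  qed (auto simp: finite_subset_edges)
  also have "\<dots> = (\<Sum>i=1..s. 16 * card (S i))"
  proof (rule sum.cong)
    fix i assume "i \<in> {1..s}"
    then have k: "card (S i) \<ge> 1" by (rule card_S_pos)
    have "card (?E i) = card (subset_edges_I S i) + card (subset_edges_II S i) +
        card (subset_edges_III S i)"
      using subset_edges_disjoint[where S = S and i = i, OF k]
      by (simp add: card_Un_disjoint finite_subset_edges Int_Un_distrib2)
    \<comment> \<open>The groups contribute 8, 8k and 8(k - 1); the truncated subtraction is exact
      since \<open>k \<ge> 1\<close>.\<close>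
    also have "\<dots> = 16 * card (S i)"
      using k by (simp add: card_subset_edges_I card_subset_edges_II card_subset_edges_III)
    finally show "card (?E i) = 16 * card (S i)" .
  qed simp
  finally show ?thesis
    by (simp add: sum_distrib_left)
qed

text \<open>Only a test on end points that separates return edges from the other kinds;
  \<open>n \<noteq> 1\<close> rejects linking edges between consecutive subset gadgets.\<close>

definition is_return_edge :: "vertex \<times> vertex \<Rightarrow> bool" where
  "is_return_edge x \<longleftrightarrow> (case x of
     (VU i m, VS q n) \<Rightarrow> True
   | (VS p m, VU i n) \<Rightarrow> True
   | (VS p m, VS q n) \<Rightarrow> p \<noteq> q \<and> n \<noteq> 1
   | _ \<Rightarrow> False)"

text \<open>Consecutive entries of \<open>F_list\<close> differ, and targets in subset gadgets have
  index 2 + \<open>d_idx\<close> or 2 + \<open>e_idx\<close>, never 1.\<close>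

lemma is_return_edgeI:
  assumes "i \<in> {1..u}" "x \<in> return_edges s S i"
  shows "is_return_edge x"
proof -
  let ?F = "nth1 (F_list s S i)"
  have "?F j \<noteq> ?F (Suc j)" if "j \<ge> 1" "j < length (F_list s S i)" for j
    using that nth1_eq_iff[OF distinct_F_list, of j i "Suc j"] by auto
  then show ?thesis
    using assms F_list_nonempty[OF assms(1)]
    by (auto simp: return_edges_def Let_def is_return_edge_def e_idx_def d_idx_def)
qed

lemma card_gamma_edges:
  "card (gamma_edges u s S) = 7 * u + s + 18 * (\<Sum>p=1..s. card (S p)) + 2"
proof -
  let ?A = "\<Union>i\<in>{1..u}. universe_edges i"
  let ?B = "\<Union>i\<in>{1..s}. subset_edges_I S i \<union> subset_edges_II S i \<union> subset_edges_III S i"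
  let ?C = "linking_edges u s"
  let ?D = "\<Union>i\<in>{1..u}. return_edges s S i"
  have A: "\<exists>i m n. x = (VU i m, VU i n) \<and> m \<noteq> 4" if "x \<in> ?A" for x
    using that by (auto simp: universe_edges_def)
  have B: "\<exists>i m n. x = (VS i m, VS i n)" if "x \<in> ?B" for x
    using that
    by (auto simp: subset_edges_I_def subset_edges_II_def subset_edges_III_def Let_def)
  have D: "is_return_edge x" if "x \<in> ?D" for x
    using that is_return_edgeI by blast
  have "?A \<inter> ?B = {}"
    using A B by blast
  \<comment> \<open>A linking edge either has an end \<open>VC\<close> or joins two different
    gadgets.\<close>
  moreover have "(?A \<union> ?B) \<inter> ?C = {}"
    using A B by (fastforce simp: linking_edges_def)
  moreover have "\<not> is_return_edge x" if "x \<in> ?A \<union> ?B \<union> ?C" for x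
  proof -
    from that consider "x \<in> ?A" | "x \<in> ?B" | "x \<in> ?C" by blast
    then show ?thesis
    proof cases
      case 1
      from A[OF this] show ?thesis by (auto simp: is_return_edge_def)
    next
      case 2
      from B[OF this] show ?thesis by (auto simp: is_return_edge_def)
    next
      case 3
      then show ?thesis by (auto simp: linking_edges_def is_return_edge_def)
    qed
  qed
  then have "(?A \<union> ?B \<union> ?C) \<inter> ?D = {}"
    using D by blast
  moreover have "finite ?A" "finite ?B" "finite ?C" "finite ?D"
    using finite_return_edges
    by (auto simp: universe_edges_def finite_subset_edges linking_edges_def)
  ultimately have "card (?A \<union> ?B \<union> ?C \<union> ?D) = card ?A + card ?B + card ?C + card ?D"
    by (simp only: card_Un_disjoint finite_Un)
  \<comment> \<open>The total is 4u + 16c + (u + s + 2) + (2u + 2c), where c is the sum of the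
    \<open>card (S p)\<close>.\<close>
  then show ?thesis
    unfolding gamma_edges_def
    using card_UN_universe_edges[of u] card_UN_subset_edges card_linking_edges[OF u_pos s_pos]
      card_UN_return_edges
    by linarith
qed

end

theorem mainTheorem2:
  fixes u s c :: nat and S :: "nat \<Rightarrow> nat set"
  assumes "ssp_instance u s S"
    and "simple_form u s S"
    and "c = (\<Sum>i=1..s. card (S i))"
  shows "card (pverts (Gamma u s S)) = 4 * u + 5 * s + 6 * c + 2 \<and>
         card (parcs (Gamma u s S)) = 7 * u + s + 18 * c + 2"
proof -
  interpret simple_ssp u s S
    using assms by unfold_locales
  show ?thesis
    using card_gamma_verts[of u s S] card_gamma_edges by (simp add: Gamma_def assms(3))
qed

end
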